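(* Let $\lambda>0$, $\mu^x\in(-\sqrt\lambda,\sqrt\lambda)$ and $\alpha\in\mathcal S(\mathbb R)$ with $\alpha\ge0$ be such that the solution of $\dot x(t)=\lambda-\alpha(t)-x(t)^2$, $x(0)=\mu^x$, diverges to $-\infty$ on $(0,\infty)$ (in finite time). Put $m_{\lambda,\alpha}=\sqrt\lambda+\mu^x$ and $\tilde{\mathrm K}(\lambda,\alpha,g)=\|g\|_{L^1([0,\infty))}/m_{\lambda,\alpha}$. Choose $\tilde\nu\ge0$ such that $\int_0^\infty\big(\alpha(s\,m_{\lambda,\alpha})-\tfrac{\tilde\nu}{2}\big)^+ds=1$. Then: (i) The function $\tilde g(s)=\big(\alpha(s\,m_{\lambda,\alpha})-\tfrac{\tilde\nu}{2}\big)^+$ is a solution of $$\min_{g\in\mathcal S(\mathbb R^+),\ g\ge0}\int_0^\infty\Big[\alpha(t)-g\Big(t\,\frac{\|g\|_{L^1([0,\infty))}}{m_{\lambda,\alpha}}\Big)\Big]^2dt .$$ (ii) The control $\tilde u(s)=\alpha(s)-\big(\alpha(s)-\tfrac{\tilde\nu}{2}\big)^+$ is an admissible control for the optimal control problem (OCP), corresponding to $\tilde g$ through $\tilde u(s)=\alpha(s)-\tilde g\big(s\,\tilde{\mathrm K}(\lambda,\alpha,\tilde g)\big)$.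
   Context: Notation: $\mathbb R^+=[0,\infty)$, $\mathcal S(\Omega)=L^1(\Omega)\cap L^\infty(\Omega)$, and $(f)^+=\max(f,0)$ is the positive part. ODE solutions are Carathéodory solutions (locally absolutely continuous, equation holding almost everywhere). The optimal control problem (OCP) is $$\min_{u\in\mathcal S(\mathbb R^+)}\int_0^\infty u^2(t)\,dt\quad\text{s.t.}\quad \dot x(t)=\lambda-\alpha(t)+u(t)-x^2(t),\quad x(0)=\mu^x,\quad \exists M\in\mathbb N:\ x(t)\ge -M\ \ \forall t\ge0 .$$ A control $u\in\mathcal S(\mathbb R^+)$ is admissible for (OCP) if the solution $x$ of the controlled initial value problem exists on $[0,\infty)$ and satisfies $x\ge -M$ there for some $M\in\mathbb N$. In this setting the initial value is taken in $(-\sqrt\lambda,\sqrt\lambda)$. For $g=0$, the function $g(t\|g\|_{L^1}/m_{\lambda,\alpha})$ is understood to be the zero function. *)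

theory Defs
  imports "HOL-Analysis.Analysis"
begin

text \<open>
  Elements of \<open>L\<^sup>1\<close> and \<open>L\<^sup>\<infinity>\<close> are represented by functions on the whole real line, of which only
  the values on \<open>\<Omega>\<close> matter; (in)equalities between them are meant almost everywhere on \<open>\<Omega>\<close>.
\<close>

definition S_space :: "real set \<Rightarrow> (real \<Rightarrow> real) set" where
  "S_space \<Omega> = {f. f absolutely_integrable_on \<Omega> \<and>
                    (\<exists>C. AE t in lebesgue. t \<in> \<Omega> \<longrightarrow> \<bar>f t\<bar> \<le> C)}"

definition L1_norm :: "real set \<Rightarrow> (real \<Rightarrow> real) \<Rightarrow> real" where
  "L1_norm \<Omega> f = (LINT t:\<Omega>|lebesgue. \<bar>f t\<bar>)"

text \<open>
  The \<open>\<epsilon>\<close>-\<open>\<delta>\<close> definition. A \<^const>\<open>division_of\<close> is a finite family of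
  nonoverlapping nonempty compact intervals, here \<open>k = [Inf k, Sup k]\<close>; only its union \<open>\<Union>d\<close> is
  required to lie in \<open>S\<close>, so \<open>d\<close> need not cover \<open>S\<close>.
\<close>

definition abs_continuous_on :: "real set \<Rightarrow> (real \<Rightarrow> real) \<Rightarrow> bool" where
  "abs_continuous_on S f \<longleftrightarrow>
     (\<forall>\<epsilon>>0. \<exists>\<delta>>0. \<forall>d. d division_of (\<Union>d) \<longrightarrow> \<Union>d \<subseteq> S \<longrightarrow>
        (\<Sum>k\<in>d. Sup k - Inf k) < \<delta> \<longrightarrow> (\<Sum>k\<in>d. \<bar>f (Sup k) - f (Inf k)\<bar>) < \<epsilon>)"

definition locally_abs_continuous_on :: "real set \<Rightarrow> (real \<Rightarrow> real) \<Rightarrow> bool" where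
  "locally_abs_continuous_on I f \<longleftrightarrow>
     (\<forall>a b. a \<le> b \<longrightarrow> {a..b} \<subseteq> I \<longrightarrow> abs_continuous_on {a..b} f)"

definition caratheodory_solution ::
    "(real \<Rightarrow> real \<Rightarrow> real) \<Rightarrow> real \<Rightarrow> real set \<Rightarrow> (real \<Rightarrow> real) \<Rightarrow> bool" where
  "caratheodory_solution F \<xi> I x \<longleftrightarrow>
     x 0 = \<xi> \<and> locally_abs_continuous_on I x \<and>
     (AE t in lebesgue. t \<in> I \<longrightarrow> (x has_real_derivative F t (x t)) (at t within I))"

definition diverges_to_minus_infinity :: "(real \<Rightarrow> real \<Rightarrow> real) \<Rightarrow> real \<Rightarrow> bool" where
  "diverges_to_minus_infinity F \<xi> \<longleftrightarrow>
     (\<exists>T>0. \<exists>x. caratheodory_solution F \<xi> {0..<T} x \<and> filterlim x at_bot (at_left T))"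

definition OCP_admissible ::
    "real \<Rightarrow> (real \<Rightarrow> real) \<Rightarrow> real \<Rightarrow> (real \<Rightarrow> real) \<Rightarrow> bool" where
  "OCP_admissible lam \<alpha> \<mu> u \<longleftrightarrow>
     u \<in> S_space {0..} \<and>
     (\<exists>x. caratheodory_solution (\<lambda>t y. lam - \<alpha> t + u t - y\<^sup>2) \<mu> {0..} x \<and>
          (\<exists>M::nat. \<forall>t\<ge>0. x t \<ge> - real M))"

definition m_const :: "real \<Rightarrow> real \<Rightarrow> real" where
  "m_const lam \<mu> = sqrt lam + \<mu>"

definition K_tilde :: "real \<Rightarrow> real \<Rightarrow> (real \<Rightarrow> real) \<Rightarrow> real" where
  "K_tilde lam \<mu> g = L1_norm {0..} g / m_const lam \<mu>"

text \<open>
  The function \<open>g(t \<parallel>g\<parallel> / m)\<close>. If \<open>g = 0\<close> in \<open>L\<^sup>1\<close> it is the zero function by convention; the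
  formula would instead give the constant \<open>g 0\<close>, which depends on the representative.
\<close>

definition rescaled :: "real \<Rightarrow> real \<Rightarrow> (real \<Rightarrow> real) \<Rightarrow> real \<Rightarrow> real" where
  "rescaled lam \<mu> g t = (if L1_norm {0..} g = 0 then 0 else g (t * K_tilde lam \<mu> g))"

definition g_cost :: "real \<Rightarrow> (real \<Rightarrow> real) \<Rightarrow> real \<Rightarrow> (real \<Rightarrow> real) \<Rightarrow> real" where
  "g_cost lam \<alpha> \<mu> g = (LINT t:{0..}|lebesgue. (\<alpha> t - rescaled lam \<mu> g t)\<^sup>2)"

definition g_feasible :: "(real \<Rightarrow> real) \<Rightarrow> bool" where
  "g_feasible g \<longleftrightarrow> g \<in> S_space {0..} \<and> (AE t in lebesgue. t \<ge> 0 \<longrightarrow> g t \<ge> 0)"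

definition g_opt :: "real \<Rightarrow> (real \<Rightarrow> real) \<Rightarrow> real \<Rightarrow> real \<Rightarrow> real \<Rightarrow> real" where
  "g_opt lam \<alpha> \<mu> \<nu> s = max (\<alpha> (s * m_const lam \<mu>) - \<nu> / 2) 0"

definition u_opt :: "(real \<Rightarrow> real) \<Rightarrow> real \<Rightarrow> real \<Rightarrow> real" where
  "u_opt \<alpha> \<nu> s = \<alpha> s - max (\<alpha> s - \<nu> / 2) 0"

end

theory Submission
  imports Defs
begin

text \<open>
  Write \<open>q = sqrt lam\<close>, \<open>m = q + \<mu>\<close> and \<open>p = (\<alpha> - \<nu> / 2)\<^sup>+\<close>. The substitution \<open>t = s * m\<close> turns the
  normalisation of \<open>\<nu>\<close> into: \<open>p\<close> has integral \<open>m\<close> over the half-line.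

  Existence of \<open>\<nu>\<close>: a solution of the uncontrolled equation that diverges to \<open>-\<infinity>\<close> crosses the strip from
  \<open>\<mu>\<close> down to \<open>- q\<close>. The drift \<open>lam - x\<^sup>2\<close> is nonnegative there, so that \<open>\<alpha>\<^sup>+\<close> has integral at least \<open>m\<close>
  (\<open>diverges_imp_forcing_mass\<close>); the intermediate value theorem then yields the level
  (\<open>positive_part_level_exists\<close>). To integrate the differential equation of a Caratheodory solution one
  needs the fundamental theorem of calculus for absolutely continuous functions
  (\<open>fundamental_theorem_abs_continuous\<close>).

  Optimality: for a nonzero \<open>g\<close>, the rescaled function \<open>h t = g (t * norm g / m)\<close> has integral \<open>m\<close>,
  independently of \<open>g\<close>, and the rescaled optimal function is \<open>p\<close>. So the problem is to approximate \<open>\<alpha>\<close> in mean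
  square by a nonnegative function of integral \<open>m\<close> (or by 0), and \<open>\<nu>\<close> is the multiplier of the integral
  constraint: \<open>(\<alpha> - h)\<^sup>2 \<ge> (\<alpha> - p)\<^sup>2 + \<nu> * (p - h)\<close> holds pointwise
  (\<open>positive_part_best_approximation\<close>).

  Admissibility: the controlled equation is \<open>x' = lam - p - x\<^sup>2\<close>. By the same strip argument a forcing of
  total mass \<open>m\<close> never pushes \<open>x\<close> below \<open>- q\<close>. A global solution comes from the Banach fixed point theorem for
  \<open>x + P\<close> with \<open>P\<close> the indefinite integral of \<open>p\<close> (\<open>riccati_global_solution\<close>); that \<open>P' = p\<close> almost
  everywhere is Lebesgue's differentiation theorem on the line
  (\<open>indefinite_integral_has_derivative_ae\<close>), derived from the Vitali covering theorem and the Henstock lemma.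
\<close>

section \<open>Absolutely continuous functions\<close>

lemma abs_continuous_on_imp_continuous_on:
  fixes f :: "real \<Rightarrow> real"
  assumes "abs_continuous_on {a..b} f"
  shows "continuous_on {a..b} f"
  unfolding continuous_on_iff
proof (intro ballI allI impI)
  fix x e :: real assume x: "x \<in> {a..b}" and e: "e > 0"
  obtain \<delta> where \<delta>: "\<delta> > 0"
    "\<And>d. d division_of (\<Union>d) \<Longrightarrow> \<Union>d \<subseteq> {a..b} \<Longrightarrow> (\<Sum>k\<in>d. Sup k - Inf k) < \<delta> \<Longrightarrow>
       (\<Sum>k\<in>d. \<bar>f (Sup k) - f (Inf k)\<bar>) < e"
    using assms e unfolding abs_continuous_on_def by blast
  have *: "\<bar>f v - f u\<bar> < e" if "u \<le> v" "a \<le> u" "v \<le> b" "v - u < \<delta>" for u v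
  proof -
    have "{{u..v}} division_of \<Union>{{u..v}}"
      using that division_of_self[of u v] by simp
    from \<delta>(2)[OF this] that show ?thesis by simp
  qed
  show "\<exists>d>0. \<forall>x'\<in>{a..b}. dist x' x < d \<longrightarrow> dist (f x') (f x) < e"
  proof (intro exI[of _ \<delta>] conjI ballI impI)
    fix y assume "y \<in> {a..b}" "dist y x < \<delta>"
    then show "dist (f y) (f x) < e"
      using *[of x y] *[of y x] x by (cases "x \<le> y") (auto simp: dist_real_def abs_minus_commute)
  qed (fact \<delta>)
qed

lemma lipschitz_imp_abs_continuous_on:
  fixes f :: "real \<Rightarrow> real"
  assumes "\<And>u v. u \<in> S \<Longrightarrow> v \<in> S \<Longrightarrow> u \<le> v \<Longrightarrow> \<bar>f v - f u\<bar> \<le> L * (v - u)" and L: "L > 0"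
  shows "abs_continuous_on S f"
  unfolding abs_continuous_on_def
proof (intro allI impI)
  fix e :: real assume e: "e > 0"
  show "\<exists>\<delta>>0. \<forall>d. d division_of \<Union> d \<longrightarrow> \<Union> d \<subseteq> S \<longrightarrow>
       (\<Sum>k\<in>d. Sup k - Inf k) < \<delta> \<longrightarrow> (\<Sum>k\<in>d. \<bar>f (Sup k) - f (Inf k)\<bar>) < e"
  proof (intro exI[of _ "e / L"] conjI allI impI)
    fix d assume d: "d division_of \<Union> d" "\<Union> d \<subseteq> S" "(\<Sum>k\<in>d. Sup k - Inf k) < e / L"
    have "(\<Sum>k\<in>d. \<bar>f (Sup k) - f (Inf k)\<bar>) \<le> (\<Sum>k\<in>d. L * (Sup k - Inf k))"
    proof (rule sum_mono)
      fix k assume k: "k \<in> d"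
      obtain u v where uv: "k = {u..v}" "u \<le> v"
        using division_ofD(3,4)[OF d(1) k] by (metis box_real(2) atLeastatMost_empty_iff2)
      then show "\<bar>f (Sup k) - f (Inf k)\<bar> \<le> L * (Sup k - Inf k)"
        using assms(1)[of u v] subsetD[OF d(2) UnionI[OF k]] by simp
    qed
    also have "\<dots> = L * (\<Sum>k\<in>d. Sup k - Inf k)" by (simp add: sum_distrib_left)
    also have "\<dots> < e" using d(3) L by (simp add: field_simps)
    finally show "(\<Sum>k\<in>d. \<bar>f (Sup k) - f (Inf k)\<bar>) < e" .
  qed (use e L in auto)
qed

text \<open>
  The fundamental theorem of calculus with a null exceptional set \<open>N\<close>. The gauge confines the intervals
  tagged in \<open>N\<close> to an open set of small measure, where absolute continuity bounds the sum of the
  increments of \<open>f\<close>; over all other intervals the increment of \<open>f\<close> is close to its linear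
  approximation.
\<close>

theorem fundamental_theorem_abs_continuous:
  fixes f g :: "real \<Rightarrow> real"
  assumes ab: "a \<le> b" and ac: "abs_continuous_on {a..b} f" and N: "negligible N"
    and deriv: "\<And>t. t \<in> {a..b} - N \<Longrightarrow> (f has_real_derivative g t) (at t within {a..b})"
  shows "(g has_integral f b - f a) {a..b}"
proof -
  \<comment> \<open>\<open>g\<close> is unconstrained on \<open>N\<close>; with the value 0 the tags in \<open>N\<close> drop out of the Riemann sums\<close>
  define g0 where "g0 t = (if t \<in> N then 0 else g t)" for t
  have "(g0 has_integral f b - f a) (cbox a b)"
    unfolding has_integral
  proof (intro allI impI)
    fix e :: real assume e: "e > 0"
    define e1 where "e1 = e / (2 * (b - a + 1))"
    have e1: "e1 > 0" "e1 * (b - a) < e / 2"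
      using ab e by (auto simp: e1_def field_simps)
    obtain \<delta> where \<delta>: "\<delta> > 0"
      "\<And>d. d division_of (\<Union>d) \<Longrightarrow> \<Union>d \<subseteq> {a..b} \<Longrightarrow> (\<Sum>k\<in>d. Sup k - Inf k) < \<delta> \<Longrightarrow>
         (\<Sum>k\<in>d. \<bar>f (Sup k) - f (Inf k)\<bar>) < e / 2"
      using ac half_gt_zero[OF e] unfolding abs_continuous_on_def by blast
    \<comment> \<open>an open set of measure less than \<open>\<delta>\<close> that contains the exceptional set\<close>
    obtain U where U: "open U" "N \<subseteq> U" "U - N \<in> lmeasurable" "emeasure lebesgue (U - N) < ennreal \<delta>"
      using sets_lebesgue_outer_open[OF negligible_imp_sets[OF N] \<delta>(1)] by metis
    have Um: "U \<in> lmeasurable"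
      using fmeasurable.Un[OF U(3) negligible_imp_measurable[OF N]] U(2) by (simp add: Un_absorb2)
    have "emeasure lebesgue U = emeasure lebesgue (U - N)"
      using N by (intro emeasure_Diff_null_set[symmetric])
        (use Um in \<open>auto simp: negligible_iff_null_sets fmeasurableD\<close>)
    then have "ennreal (measure lebesgue U) < ennreal \<delta>"
      using U(4) Um by (simp add: emeasure_eq_measure2)
    then have mU: "measure lebesgue U < \<delta>"
      by (simp add: ennreal_less_iff)
    have "\<exists>d>0. \<forall>y\<in>{a..b}. \<bar>y - t\<bar> < d \<longrightarrow> \<bar>f y - f t - g t * (y - t)\<bar> \<le> e1 * \<bar>y - t\<bar>"
      if "t \<in> {a..b} - N" for t
      using deriv[OF that] e1(1) unfolding has_field_derivative_def has_derivative_within_alt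
      by (simp add: real_norm_def)
    then obtain r where r: "\<And>t. t \<in> {a..b} - N \<Longrightarrow> r t > 0"
      "\<And>t y. t \<in> {a..b} - N \<Longrightarrow> y \<in> {a..b} \<Longrightarrow> \<bar>y - t\<bar> < r t \<Longrightarrow>
          \<bar>f y - f t - g t * (y - t)\<bar> \<le> e1 * \<bar>y - t\<bar>"
      by metis
    define \<gamma> where "\<gamma> t = (if t \<in> N then U else if t \<in> {a..b} then ball t (r t) else ball t 1)" for t
    have "gauge \<gamma>"
      unfolding gauge_def \<gamma>_def using U r(1) by auto
    moreover have bound: "norm ((\<Sum>(t,k)\<in>p. measure lborel k *\<^sub>R g0 t) - (f b - f a)) < e"
      if p: "p tagged_division_of cbox a b" and fine: "\<gamma> fine p" for p
    proof -
      have fin: "finite p" using p by blast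
      have *: "\<exists>u v. k = {u..v} \<and> u \<le> t \<and> t \<le> v \<and> a \<le> u \<and> v \<le> b \<and> k \<subseteq> \<gamma> t"
        if tk: "(t, k) \<in> p" for t k
      proof -
        obtain u v where k: "k = {u..v}" using tagged_division_ofD(4)[OF p tk] by auto
        then have "u \<le> t" "t \<le> v" using tagged_division_ofD(2)[OF p tk] by auto
        moreover have "{u..v} \<subseteq> {a..b}" using tagged_division_ofD(3)[OF p tk] k by simp
        ultimately show ?thesis
          using k fineD[OF fine tk] by (intro exI[of _ u] exI[of _ v]) auto
      qed
      define pN where "pN = {(t, k) \<in> p. t \<in> N}"
      define E where "E tk = (case tk of (t, k) \<Rightarrow> measure lborel k * g0 t - (f (Sup k) - f (Inf k)))" for tk
      \<comment> \<open>the case distinction is needed because \<open>Sup {}\<close> and \<open>Inf {}\<close> are unspecified reals\<close>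
      define D where "D k = (if k = {} then 0 else \<bar>f (Sup k) - f (Inf k)\<bar>)" for k
      have pN: "pN tagged_division_of \<Union>(snd ` pN)"
        by (rule tagged_partial_division_of_Union_self, rule tagged_partial_division_subset)
          (use p in \<open>auto simp: tagged_division_of_def pN_def\<close>)
      have dN: "snd ` pN division_of \<Union>(snd ` pN)"
        by (rule division_of_tagged_division[OF pN])
      have "\<bar>\<Sum>tk\<in>pN. E tk\<bar> \<le> (\<Sum>(t,k)\<in>pN. \<bar>f (Sup k) - f (Inf k)\<bar>)"
        by (rule order_trans[OF sum_abs], rule sum_mono)
          (auto simp: pN_def E_def g0_def)
      also have "\<dots> = (\<Sum>(t,k)\<in>pN. D k)"
        using tagged_division_ofD(2)[OF pN] by (intro sum.cong[OF refl]) (fastforce simp: D_def)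
      also have "\<dots> = (\<Sum>k\<in>snd ` pN. D k)"
        by (rule sum.over_tagged_division_lemma[OF pN]) (auto simp: D_def)
      also have "\<dots> = (\<Sum>k\<in>snd ` pN. \<bar>f (Sup k) - f (Inf k)\<bar>)"
        using division_ofD(3)[OF dN] by (intro sum.cong) (auto simp: D_def)
      also have "\<dots> < e / 2"
      proof (rule \<delta>(2)[OF dN])
        show sub: "\<Union> (snd ` pN) \<subseteq> {a..b}"
          using * by (fastforce simp: pN_def)
        have "(\<Sum>k\<in>snd ` pN. Sup k - Inf k) = (\<Sum>k\<in>snd ` pN. measure lebesgue k)"
        proof (rule sum.cong[OF refl])
          fix k assume "k \<in> snd ` pN"
          then obtain t where "(t, k) \<in> p" by (auto simp: pN_def)
          from *[OF this] obtain u v where "k = {u..v}" "u \<le> v" by auto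
          then show "Sup k - Inf k = measure lebesgue k" by simp
        qed
        also have "\<dots> = measure lebesgue (\<Union> (snd ` pN))"
          by (rule content_division[OF dN])
        also have "\<dots> \<le> measure lebesgue U"
        proof (rule measure_mono_fmeasurable[OF _ _ Um])
          show "\<Union> (snd ` pN) \<subseteq> U"
          proof clarsimp
            fix y t k assume y: "y \<in> k" "(t, k) \<in> pN"
            then have "k \<subseteq> \<gamma> t" "t \<in> N" using *[of t k] by (auto simp: pN_def)
            with y show "y \<in> U" by (auto simp: \<gamma>_def)
          qed
          show "\<Union> (snd ` pN) \<in> sets lebesgue"
            using dN lmeasurable_division by blast
        qed
        also have "\<dots> < \<delta>" by (fact mU)
        finally show "(\<Sum>k\<in>snd ` pN. Sup k - Inf k) < \<delta>" .
      qed
      finally have 1: "\<bar>\<Sum>tk\<in>pN. E tk\<bar> < e / 2" .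
      have "\<bar>\<Sum>tk\<in>p - pN. E tk\<bar> \<le> (\<Sum>(t,k)\<in>p - pN. e1 * measure lborel k)"
      proof (rule order_trans[OF sum_abs], rule sum_mono, clarify)
        fix t k assume tk: "(t, k) \<in> p" "(t, k) \<notin> pN"
        then obtain u v where uv: "k = {u..v}" "u \<le> t" "t \<le> v" "a \<le> u" "v \<le> b" "k \<subseteq> \<gamma> t"
          using * by blast
        have t: "t \<in> {a..b} - N" using tk uv by (auto simp: pN_def)
        have "u \<in> ball t (r t)" "v \<in> ball t (r t)"
          using uv t by (auto simp: \<gamma>_def subset_iff)
        then have "\<bar>f u - f t - g t * (u - t)\<bar> \<le> e1 * \<bar>u - t\<bar>" "\<bar>f v - f t - g t * (v - t)\<bar> \<le> e1 * \<bar>v - t\<bar>"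
          using r(2)[OF t, of u] r(2)[OF t, of v] uv by (auto simp: dist_real_def)
        moreover have "E (t, k) = (f u - f t - g t * (u - t)) - (f v - f t - g t * (v - t))"
          using uv t by (simp add: E_def g0_def algebra_simps)
        ultimately show "\<bar>E (t, k)\<bar> \<le> e1 * measure lborel k"
          using uv by (simp add: algebra_simps)
      qed
      also have "\<dots> \<le> (\<Sum>(t,k)\<in>p. e1 * measure lborel k)"
        using fin e1(1) by (intro sum_mono2) auto
      also have "\<dots> = e1 * (\<Sum>(t,k)\<in>p. measure lborel k)"
        by (simp add: sum_distrib_left case_prod_unfold)
      also have "\<dots> = e1 * (b - a)"
        using additive_content_tagged_division[OF p] ab by simp
      finally have 2: "\<bar>\<Sum>tk\<in>p - pN. E tk\<bar> < e / 2" using e1 by simp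
      have "(\<Sum>(t,k)\<in>p. measure lborel k *\<^sub>R g0 t) - (f b - f a) = (\<Sum>tk\<in>p. E tk)"
        using additive_tagged_division_1[OF ab, of p f] p
        by (simp add: E_def case_prod_unfold sum_subtractf)
      also have "\<dots> = (\<Sum>tk\<in>p - pN. E tk) + (\<Sum>tk\<in>pN. E tk)"
        using fin by (intro sum.subset_diff) (auto simp: pN_def)
      finally show ?thesis using 1 2 by simp
    qed
    ultimately show "\<exists>\<gamma>. gauge \<gamma> \<and> (\<forall>p. p tagged_division_of cbox a b \<and> \<gamma> fine p \<longrightarrow>
        norm ((\<Sum>(t,k)\<in>p. measure lborel k *\<^sub>R g0 t) - (f b - f a)) < e)"
      using bound by (intro exI[of _ \<gamma>] conjI allI impI) (assumption, elim conjE, rule bound)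
  qed
  then have "(g0 has_integral f b - f a) {a..b}" by simp
  then show ?thesis
    by (rule has_integral_spike[OF N, rotated]) (auto simp: g0_def)
qed

section \<open>Differentiation of indefinite integrals\<close>

text \<open>
  Lebesgue differentiation on the line. Fix \<open>e\<close> and let \<open>S\<close> be the set of the points \<open>t\<close> that lie in
  arbitrarily short intervals over which the mean of \<open>f\<close> differs from \<open>f t\<close> by at least \<open>e\<close>. Those
  intervals form a Vitali cover of \<open>S\<close>, and the Henstock lemma bounds the total length of any
  finite disjoint family of them that is fine for a suitable gauge.
\<close>

lemma negligible_bad_mean_points:
  fixes f :: "real \<Rightarrow> real"
  assumes f: "f integrable_on {a..b}" and e: "e > 0"
  shows "negligible {t. \<forall>d>0. \<exists>u v. u \<le> t \<and> t \<le> v \<and> u < v \<and> v - u < d \<and> {u..v} \<subseteq> {a..b} \<and>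
            \<bar>integral {u..v} f - (v - u) * f t\<bar> \<ge> e * (v - u)}" (is "negligible ?S")
  unfolding negligible_outer_le
proof (intro allI impI)
  fix \<epsilon> :: real assume \<epsilon>: "\<epsilon> > 0"
  obtain \<gamma> where \<gamma>: "gauge \<gamma>"
    "\<And>p. p tagged_partial_division_of {a..b} \<Longrightarrow> \<gamma> fine p \<Longrightarrow>
       (\<Sum>(t,k)\<in>p. norm (measure lborel k *\<^sub>R f t - integral k f)) < e * \<epsilon>"
    using Henstock_lemma[of f a b "e * \<epsilon>"] f e \<epsilon> by auto
  define K where "K = {(t, u, v). u \<le> t \<and> t \<le> v \<and> u < v \<and> {u..v} \<subseteq> {a..b} \<and> {u..v} \<subseteq> \<gamma> t \<and>
      \<bar>integral {u..v} f - (v - u) * f t\<bar> \<ge> e * (v - u)}"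
  \<comment> \<open>midpoint and radius of the interval \<open>{u..v}\<close>, of which \<open>t\<close> is any point\<close>
  define c where "c = (\<lambda>(t::real, u, v). (u + v) / 2 :: real)"
  define r where "r = (\<lambda>(t::real, u, v). (v - u) / 2 :: real)"
  have cball: "cball (c i) (r i) = {fst (snd i)..snd (snd i)}" for i
    by (cases i) (auto simp: c_def r_def cball_def dist_real_def abs_le_iff field_simps)
  have vit: "\<exists>i. i \<in> K \<and> x \<in> cball (c i) (r i) \<and> r i < d" if x: "x \<in> ?S" and d: "d > 0" for x d
  proof -
    obtain q where q: "q > 0" "ball x q \<subseteq> \<gamma> x"
      using gaugeD[OF \<gamma>(1), of x] open_contains_ball by blast
    obtain u v where uv: "u \<le> x" "x \<le> v" "u < v" "v - u < min d q" "{u..v} \<subseteq> {a..b}"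
        "\<bar>integral {u..v} f - (v - u) * f x\<bar> \<ge> e * (v - u)"
      using x d q(1) by (auto dest: spec[of _ "min d q"])
    have "{u..v} \<subseteq> ball x q" using uv by (auto simp: dist_real_def)
    with q uv have "(x, u, v) \<in> K" by (auto simp: K_def)
    moreover have "x \<in> cball (c (x, u, v)) (r (x, u, v))" using uv by (simp add: cball)
    moreover have "r (x, u, v) < d" using uv d by (simp add: r_def)
    ultimately show ?thesis by blast
  qed
  have rpos: "0 < r i" if "i \<in> K" for i
    using that by (auto simp: K_def r_def)
  obtain C where C: "countable C" "C \<subseteq> K"
     "pairwise (\<lambda>i j. disjnt (cball (c i) (r i)) (cball (c j) (r j))) C"
     "negligible (?S - (\<Union>i \<in> C. cball (c i) (r i)))"
    by (rule Vitali_covering_theorem_cballs[OF rpos vit])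
  have fin_bound: "measure lebesgue (\<Union>i\<in>I. cball (c i) (r i)) \<le> \<epsilon>" if I: "I \<subseteq> C" "finite I" for I
  proof -
    define T where "T = (\<lambda>(t::real, u::real, v). (t, {u..v}))"
    have inj: "inj_on T I"
    proof (rule inj_onI)
      fix i j assume ij: "i \<in> I" "j \<in> I" "T i = T j"
      obtain t u v where i: "i = (t, u, v)" by (cases i)
      obtain t' u' v' where j: "j = (t', u', v')" by (cases j)
      have "u < v" using ij I C(2) i by (auto simp: K_def)
      with ij i j show "i = j" by (auto simp: T_def)
    qed
    have p: "T ` I tagged_partial_division_of {a..b}"
      unfolding tagged_partial_division_of_def
    proof (intro conjI allI impI)
      show "finite (T ` I)" using I by simp
    next
      fix t k assume "(t, k) \<in> T ` I"
      then obtain u v where "(t, u, v) \<in> K" "k = {u..v}" using I C(2) by (auto simp: T_def)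
      then show "t \<in> k" "k \<subseteq> {a..b}" "\<exists>a b. k = cbox a b" by (auto simp: K_def)
    next
      fix t k t' k' assume *: "(t, k) \<in> T ` I \<and> (t', k') \<in> T ` I \<and> (t, k) \<noteq> (t', k')"
      then obtain i j where ij: "i \<in> I" "j \<in> I" "(t, k) = T i" "(t', k') = T j"
        unfolding image_iff by blast
      then have "i \<noteq> j" using * by auto
      then have "disjnt (cball (c i) (r i)) (cball (c j) (r j))"
        using C(3) I ij by (auto simp: pairwise_def)
      moreover have "k = cball (c i) (r i)" "k' = cball (c j) (r j)"
        using ij unfolding cball by (auto simp: T_def case_prod_unfold)
      ultimately show "interior k \<inter> interior k' = {}"
        using interior_subset unfolding disjnt_def by blast
    qed
    have fine: "\<gamma> fine (T ` I)"
      unfolding fine_def using I C(2) by (auto simp: T_def K_def)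
    have "measure lebesgue (\<Union>i\<in>I. cball (c i) (r i)) \<le> (\<Sum>i\<in>I. measure lebesgue (cball (c i) (r i)))"
      using I by (intro measure_UNION_le) auto
    also have "e * \<dots> = (\<Sum>(t,u,v)\<in>I. e * (v - u))"
      unfolding cball sum_distrib_left using I C(2)
      by (intro sum.cong) (auto simp: K_def)
    also have "\<dots> \<le> (\<Sum>i\<in>I. case T i of (t,k) \<Rightarrow> norm (measure lborel k *\<^sub>R f t - integral k f))"
      using I C(2) by (intro sum_mono) (auto simp: K_def T_def abs_minus_commute)
    also have "\<dots> = (\<Sum>(t,k)\<in>T ` I. norm (measure lborel k *\<^sub>R f t - integral k f))"
      by (simp add: sum.reindex[OF inj] o_def)
    also have "\<dots> < e * \<epsilon>" by (rule \<gamma>(2)[OF p fine])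
    finally show ?thesis using e by (simp add: mult_left_mono)
  qed
  have U: "(\<Union>i\<in>C. cball (c i) (r i)) \<in> lmeasurable" "measure lebesgue (\<Union>i\<in>C. cball (c i) (r i)) \<le> \<epsilon>"
    using fmeasurable_UN_bound[OF C(1), of "\<lambda>i. cball (c i) (r i)" lebesgue \<epsilon>]
      measure_UN_bound[OF C(1), of "\<lambda>i. cball (c i) (r i)" lebesgue \<epsilon>] fin_bound by auto
  let ?T = "(\<Union>i\<in>C. cball (c i) (r i)) \<union> (?S - (\<Union>i\<in>C. cball (c i) (r i)))"
  show "\<exists>T. ?S \<subseteq> T \<and> T \<in> lmeasurable \<and> measure lebesgue T \<le> \<epsilon>"
  proof (intro exI[of _ ?T] conjI)
    show "?T \<in> lmeasurable"
      using U(1) C(4) negligible_imp_measurable by (intro fmeasurable.Un) auto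
    have "measure lebesgue ?T \<le> measure lebesgue (\<Union>i\<in>C. cball (c i) (r i)) +
        measure lebesgue (?S - (\<Union>i\<in>C. cball (c i) (r i)))"
      using U(1) C(4) negligible_imp_measurable by (intro measure_Un_le) (auto simp: fmeasurableD)
    then show "measure lebesgue ?T \<le> \<epsilon>"
      using U(2) negligible_imp_measure0[OF C(4)] by simp
  qed blast
qed

theorem indefinite_integral_has_derivative_ae:
  fixes f :: "real \<Rightarrow> real"
  assumes f: "f integrable_on {a..b}"
  obtains N where "negligible N"
    "\<And>t. t \<in> {a<..<b} - N \<Longrightarrow> ((\<lambda>x. integral {a..x} f) has_real_derivative f t) (at t)"
proof
  define S where "S e = {t. \<forall>d>0. \<exists>u v. u \<le> t \<and> t \<le> v \<and> u < v \<and> v - u < d \<and> {u..v} \<subseteq> {a..b} \<and>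
            \<bar>integral {u..v} f - (v - u) * f t\<bar> \<ge> e * (v - u)}" for e
  show "negligible (\<Union>n::nat. S (1 / Suc n))"
  proof (rule negligible_countable_Union)
    show "negligible A" if "A \<in> range (\<lambda>n::nat. S (1 / Suc n))" for A
    proof -
      from that obtain n where "A = S (1 / Suc n)" by blast
      moreover have "negligible (S (1 / Suc n))"
        unfolding S_def by (rule negligible_bad_mean_points[OF f]) simp
      ultimately show ?thesis by simp
    qed
  qed simp
  fix t assume t: "t \<in> {a<..<b} - (\<Union>n::nat. S (1 / Suc n))"
  show "((\<lambda>x. integral {a..x} f) has_real_derivative f t) (at t)"
    unfolding has_field_derivative_def has_derivative_at_alt
  proof (intro conjI allI impI)
    fix e :: real assume "e > 0"
    then obtain n where n: "1 / Suc n < e" by (rule nat_approx_posE)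
    have "t \<notin> S (1 / Suc n)" using t by blast
    then obtain d0 where d0: "d0 > 0"
      "\<And>u v. u \<le> t \<Longrightarrow> t \<le> v \<Longrightarrow> u < v \<Longrightarrow> v - u < d0 \<Longrightarrow> {u..v} \<subseteq> {a..b} \<Longrightarrow>
            \<not> \<bar>integral {u..v} f - (v - u) * f t\<bar> \<ge> 1 / Suc n * (v - u)"
      unfolding S_def by blast
    define d where "d = min d0 (min (t - a) (b - t))"
    have d: "d > 0" "d \<le> d0" "a \<le> t - d" "t + d \<le> b" using t d0 by (auto simp: d_def)
    have comb: "integral {a..v} f - integral {a..u} f = integral {u..v} f"
      if "a \<le> u" "u \<le> v" "v \<le> b" for u v
      using Henstock_Kurzweil_Integration.integral_combine[OF that(1,2), of f] integrable_subinterval_real[OF f, of a v] that by simp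
    have key: "\<bar>integral {u..v} f - (v - u) * f t\<bar> \<le> e * (v - u)"
      if "u \<le> t" "t \<le> v" "u < v" "v - u < d" "a \<le> u" "v \<le> b" for u v
    proof -
      have "\<bar>integral {u..v} f - (v - u) * f t\<bar> < 1 / Suc n * (v - u)"
        using d0(2)[of u v] that d by auto
      also have "\<dots> \<le> e * (v - u)" using n that by (intro mult_right_mono) auto
      finally show ?thesis by simp
    qed
    show "\<exists>d>0. \<forall>y. norm (y - t) < d \<longrightarrow>
        norm (integral {a..y} f - integral {a..t} f - f t * (y - t)) \<le> e * norm (y - t)"
    proof (intro exI[of _ d] conjI allI impI d(1))
      fix y assume y: "norm (y - t) < d"
      consider "y = t" | "t < y" | "y < t" by linarith
      then show "norm (integral {a..y} f - integral {a..t} f - f t * (y - t)) \<le> e * norm (y - t)"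
      proof cases
        case 2
        then show ?thesis using key[of t y] comb[of t y] y d by (simp add: algebra_simps)
      next
        case 3
        then show ?thesis using key[of y t] comb[of y t] y d by (simp add: algebra_simps abs_le_iff)
      qed simp
    qed
  qed (rule bounded_linear_mult_right)
qed

section \<open>A Riccati equation with integrable forcing\<close>

lemma last_time_le:
  fixes f :: "real \<Rightarrow> real"
  assumes "a \<le> b" "continuous_on {a..b} f" "f a \<le> c"
  shows "\<exists>s\<in>{a..b}. f s \<le> c \<and> (\<forall>r\<in>{s<..b}. f r > c)"
proof -
  have "compact ({a..b} \<inter> f -` {..c})"
    using assms(2) by (auto intro!: continuous_closed_preimage simp: compact_eq_bounded_closed bounded_Int)
  moreover have "a \<in> {a..b} \<inter> f -` {..c}" using assms by auto
  ultimately obtain s where s: "s \<in> {a..b} \<inter> f -` {..c}" "\<forall>r\<in>{a..b} \<inter> f -` {..c}. r \<le> s"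
    using compact_attains_sup[of "{a..b} \<inter> f -` {..c}"] by blast
  then show ?thesis by (intro bexI[of _ s]) (force simp: not_le[symmetric])+
qed

lemma first_time_le:
  fixes f :: "real \<Rightarrow> real"
  assumes "a \<le> b" "continuous_on {a..b} f" "f b \<le> c"
  shows "\<exists>s\<in>{a..b}. f s \<le> c \<and> (\<forall>r\<in>{a..<s}. f r > c)"
proof -
  have "compact ({a..b} \<inter> f -` {..c})"
    using assms(2) by (auto intro!: continuous_closed_preimage simp: compact_eq_bounded_closed bounded_Int)
  moreover have "b \<in> {a..b} \<inter> f -` {..c}" using assms by auto
  ultimately obtain s where s: "s \<in> {a..b} \<inter> f -` {..c}" "\<forall>r\<in>{a..b} \<inter> f -` {..c}. s \<le> r"
    using compact_attains_inf[of "{a..b} \<inter> f -` {..c}"] by blast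
  then show ?thesis by (intro bexI[of _ s]) (force simp: not_le[symmetric])+
qed

lemma continuous_on_indefinite_integral_halfline:
  fixes g :: "real \<Rightarrow> real"
  assumes g: "\<And>t. t \<ge> 0 \<Longrightarrow> g integrable_on {0..t}"
  shows "continuous_on {0..} (\<lambda>t. integral {0..t} g)"
  unfolding continuous_on_eq_continuous_within
proof
  fix t :: real assume t: "t \<in> {0..}"
  have "continuous_on {0..t + 1} (\<lambda>t. integral {0..t} g)"
    using indefinite_integral_continuous_1 g[of "t + 1"] t by simp
  then have "continuous (at t within {0..t + 1}) (\<lambda>t. integral {0..t} g)"
    using t by (simp add: continuous_on_eq_continuous_within)
  moreover have "at t within {0..} = at t within {0..t + 1}"
    by (rule at_within_nhd[of t "{..<t + 1}"]) auto
  ultimately show "continuous (at t within {0..}) (\<lambda>t. integral {0..t} g)" by simp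
qed

text \<open>
  The Picard operator of a bounded right-hand side that is Lipschitz with constant \<open>L\<close> is a
  contraction of the bounded continuous functions for the weighted unknown
  \<open>v t = exp (- 2 * L * t) * w t\<close>; the weight makes one fixed-point argument serve for the whole
  half-line.
\<close>

lemma global_lipschitz_ode_solution:
  fixes G :: "real \<Rightarrow> real \<Rightarrow> real"
  assumes cont: "continuous_on ({0..} \<times> UNIV) (\<lambda>(t, y). G t y)"
    and bound: "\<And>t y. t \<ge> 0 \<Longrightarrow> \<bar>G t y\<bar> \<le> B"
    and lip: "\<And>t y z. t \<ge> 0 \<Longrightarrow> \<bar>G t y - G t z\<bar> \<le> L * \<bar>y - z\<bar>" and L: "L > 0"
  obtains w where "continuous_on {0..} w"
    "\<And>t. t \<ge> 0 \<Longrightarrow> w t = w0 + integral {0..t} (\<lambda>s. G s (w s))"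
proof -
  define \<phi> where "\<phi> v = (\<lambda>s. G s (exp (2 * L * s) * v s))" for v :: "real \<Rightarrow> real"
  define \<Phi> where "\<Phi> v t = exp (- (2 * L * max t 0)) * (w0 + integral {0..max t 0} (\<phi> v))"
    for v :: "real \<Rightarrow> real" and t
  have B: "B \<ge> 0" using bound[of 0 0] by simp
  have cont_\<phi>: "continuous_on {0..} (\<phi> v)" if "continuous_on UNIV v" for v
  proof -
    have "continuous_on {0..} (\<lambda>s. (s, exp (2 * L * s) * v s))"
      by (intro continuous_intros continuous_on_subset[OF that]) auto
    from continuous_on_compose2[OF cont this] show ?thesis by (auto simp: \<phi>_def)
  qed
  have int_\<phi>: "\<phi> v integrable_on {0..t}" if "continuous_on UNIV v" for v t
    by (rule integrable_continuous_interval, rule continuous_on_subset[OF cont_\<phi>[OF that]]) auto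
  have \<Phi>: "\<Phi> v \<in> bcontfun" if v: "continuous_on UNIV v" for v
  proof (rule bcontfun_normI)
    have "continuous_on {0..} (\<lambda>t. exp (- (2 * L * t)) * (w0 + integral {0..t} (\<phi> v)))"
      by (intro continuous_intros continuous_on_indefinite_integral_halfline int_\<phi> v)
    moreover have "continuous_on UNIV (\<lambda>t::real. max t 0)"
      by (intro continuous_intros)
    ultimately show "continuous_on UNIV (\<Phi> v)"
      unfolding \<Phi>_def by (rule continuous_on_compose2) auto
    fix t :: real
    define p where "p = max t 0"
    have p: "p \<ge> 0" by (simp add: p_def)
    have "\<bar>integral {0..p} (\<phi> v)\<bar> \<le> B * p"
      using integral_bound[of 0 p "\<phi> v" B] p bound continuous_on_subset[OF cont_\<phi>[OF v], of "{0..p}"]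
      by (auto simp: \<phi>_def)
    moreover have "exp (- (2 * L * p)) * (B * p) \<le> B / (2 * L)"
    proof -
      have "2 * L * p \<le> exp (2 * L * p)" using exp_ge_add_one_self[of "2 * L * p"] by linarith
      then have "B * (2 * L * p) \<le> B * exp (2 * L * p)" using B by (intro mult_left_mono)
      then show ?thesis using L by (simp add: exp_minus field_simps)
    qed
    moreover have "exp (- (2 * L * p)) * \<bar>w0\<bar> \<le> \<bar>w0\<bar>"
      using L p by (intro mult_left_le_one_le) auto
    moreover have "\<bar>\<Phi> v t\<bar> \<le> exp (- (2 * L * p)) * (\<bar>w0\<bar> + \<bar>integral {0..p} (\<phi> v)\<bar>)"
      unfolding \<Phi>_def p_def[symmetric] abs_mult by (simp add: abs_triangle_ineq)
    moreover have "exp (- (2 * L * p)) * \<bar>integral {0..p} (\<phi> v)\<bar> \<le> exp (- (2 * L * p)) * (B * p)"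
      by (intro mult_left_mono calculation(1)) simp
    ultimately show "norm (\<Phi> v t) \<le> \<bar>w0\<bar> + B / (2 * L)"
      unfolding real_norm_def distrib_left by linarith
  qed
  define T where "T v = Bcontfun (\<Phi> (apply_bcontfun v))" for v :: "real \<Rightarrow>\<^sub>C real"
  have T: "apply_bcontfun (T v) = \<Phi> (apply_bcontfun v)" for v
    unfolding T_def by (intro Bcontfun_inverse \<Phi>) simp
  have "\<exists>!v. T v = v"
  proof (rule banach_fix_type[of "1/2"])
    show "\<forall>v1 v2. dist (T v1) (T v2) \<le> 1 / 2 * dist v1 v2"
    proof (intro allI dist_bound)
      fix v1 v2 :: "real \<Rightarrow>\<^sub>C real" and t :: real
      define p where "p = max t 0"
      define D where "D = dist v1 v2"
      have p: "p \<ge> 0" by (simp add: p_def)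
      have D: "D \<ge> 0" by (simp add: D_def)
      have "((\<lambda>s. L * D * exp (2 * L * s)) has_integral (D / 2 * exp (2 * L * p) - D / 2 * exp (2 * L * 0))) {0..p}"
        using p L by (intro fundamental_theorem_of_calculus)
          (auto intro!: derivative_eq_intros simp flip: has_real_derivative_iff_has_vector_derivative)
      then have exp_int: "((\<lambda>s. L * D * exp (2 * L * s)) has_integral (D / 2 * (exp (2 * L * p) - 1))) {0..p}"
        by (simp add: algebra_simps)
      have "norm (integral {0..p} (\<lambda>s. \<phi> v1 s - \<phi> v2 s)) \<le> integral {0..p} (\<lambda>s. L * D * exp (2 * L * s))"
      proof (rule integral_norm_bound_integral)
        show "(\<lambda>s. \<phi> v1 s - \<phi> v2 s) integrable_on {0..p}"
          by (intro integrable_diff int_\<phi>) auto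
        show "(\<lambda>s. L * D * exp (2 * L * s)) integrable_on {0..p}" using exp_int by blast
        fix s assume s: "s \<in> {0..p}"
        have "\<bar>\<phi> v1 s - \<phi> v2 s\<bar> \<le> L * \<bar>exp (2 * L * s) * v1 s - exp (2 * L * s) * v2 s\<bar>"
          unfolding \<phi>_def using s by (intro lip) auto
        also have "\<dots> = L * exp (2 * L * s) * \<bar>v1 s - v2 s\<bar>"
          by (simp add: abs_mult flip: right_diff_distrib)
        also have "\<dots> \<le> L * exp (2 * L * s) * D"
          using dist_bounded[of v1 s v2] L by (intro mult_left_mono) (auto simp: D_def dist_real_def)
        finally show "norm (\<phi> v1 s - \<phi> v2 s) \<le> L * D * exp (2 * L * s)" by (simp add: mult_ac)
      qed
      also have "\<dots> = D / 2 * (exp (2 * L * p) - 1)" using exp_int by (rule integral_unique)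
      also have "\<dots> \<le> D / 2 * exp (2 * L * p)" using D by (intro mult_left_mono) auto
      finally have *: "\<bar>integral {0..p} (\<phi> v1) - integral {0..p} (\<phi> v2)\<bar> \<le> D / 2 * exp (2 * L * p)"
        by (simp add: integral_diff int_\<phi>)
      have "dist (T v1 t) (T v2 t) = \<bar>\<Phi> v1 t - \<Phi> v2 t\<bar>"
        by (simp add: T dist_real_def)
      also have "\<dots> = exp (- (2 * L * p)) * \<bar>integral {0..p} (\<phi> v1) - integral {0..p} (\<phi> v2)\<bar>"
        unfolding \<Phi>_def p_def[symmetric] by (simp add: abs_mult flip: right_diff_distrib)
      also have "\<dots> \<le> exp (- (2 * L * p)) * (D / 2 * exp (2 * L * p))"
        by (intro mult_left_mono *) simp
      also have "\<dots> = 1 / 2 * D" by (simp add: exp_minus)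
      finally show "dist (T v1 t) (T v2 t) \<le> 1 / 2 * dist v1 v2" by (simp add: D_def)
    qed
  qed auto
  then obtain v where "T v = v" by blast
  then have v: "apply_bcontfun v = \<Phi> v" using T by metis
  show thesis
  proof
    show "continuous_on {0..} (\<lambda>t. exp (2 * L * t) * v t)"
      by (intro continuous_intros) auto
    fix t :: real assume t: "t \<ge> 0"
    have "exp (2 * L * t) * v t = exp (2 * L * t) * \<Phi> v t" using v by metis
    also have "\<dots> = w0 + integral {0..t} (\<phi> v)"
      using t by (simp add: \<Phi>_def mult.assoc[symmetric] flip: exp_add)
    finally show "exp (2 * L * t) * v t = w0 + integral {0..t} (\<lambda>s. G s (exp (2 * L * s) * v s))"
      by (simp add: \<phi>_def)
  qed
qed

text \<open>
  The substitution \<open>w = x + H\<close> with \<open>H t = integral {0..t} h\<close> removes the discontinuous forcing from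
  the equation, and cutting \<open>y\<close> off to \<open>[-q, q]\<close>, where \<open>q = sqrt lam\<close>, makes the right-hand side
  bounded and Lipschitz. The cut-off is inactive on the solution: the cut-off drift \<open>lam - y\<^sup>2\<close> is
  nonnegative, so that \<open>x t \<ge> \<mu> - H t \<ge> - q\<close>, and it vanishes for \<open>y \<ge> q\<close>, so that \<open>x\<close> cannot rise
  above \<open>q\<close>.
\<close>

lemma riccati_global_solution:
  fixes h :: "real \<Rightarrow> real"
  assumes lam: "lam > 0" and \<mu>: "\<mu> \<in> {- sqrt lam..sqrt lam}"
    and h: "\<And>t. t \<ge> 0 \<Longrightarrow> h integrable_on {0..t}" "\<And>t. 0 \<le> h t" "\<And>t. h t \<le> C"
    and H_le: "\<And>t. t \<ge> 0 \<Longrightarrow> integral {0..t} h \<le> sqrt lam + \<mu>"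
  obtains x where "caratheodory_solution (\<lambda>t y. lam - h t - y\<^sup>2) \<mu> {0..} x"
    "\<And>t. t \<ge> 0 \<Longrightarrow> x t \<ge> - sqrt lam"
proof -
  define q where "q = sqrt lam"
  have q: "q > 0" "q\<^sup>2 = lam" using lam by (auto simp: q_def)
  define cut where "cut y = max (- q) (min q y)" for y
  have cut: "\<bar>cut y\<bar> \<le> q" for y using q by (auto simp: cut_def)
  have cut_sq: "(cut y)\<^sup>2 \<le> lam" for y
    using cut[of y] q by (metis abs_le_square_iff abs_of_pos)
  have cut_lip: "\<bar>cut y - cut z\<bar> \<le> \<bar>y - z\<bar>" for y z
    by (auto simp: cut_def)
  define H where "H t = integral {0..t} h" for t
  have contH: "continuous_on {0..} H"
    unfolding H_def by (rule continuous_on_indefinite_integral_halfline[OF h(1)])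
  have cont_cut: "continuous_on S (\<lambda>s. cut (f s))" if "continuous_on S f"
    for f :: "'a::topological_space \<Rightarrow> real" and S
    unfolding cut_def by (intro continuous_intros that)
  obtain w where w: "continuous_on {0..} w"
    "\<And>t. t \<ge> 0 \<Longrightarrow> w t = \<mu> + integral {0..t} (\<lambda>s. lam - (cut (w s - H s))\<^sup>2)"
  proof (rule global_lipschitz_ode_solution[where G = "\<lambda>t y. lam - (cut (y - H t))\<^sup>2" and B = lam
        and L = "2 * q" and ?w0.0 = \<mu>])
    have "continuous_on ({0..} \<times> UNIV) (\<lambda>p. H (fst p))"
      by (rule continuous_on_compose2[OF contH]) (auto intro!: continuous_intros)
    then show "continuous_on ({0..} \<times> UNIV) (\<lambda>(t, y). lam - (cut (y - H t))\<^sup>2)"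
      unfolding case_prod_unfold by (intro continuous_intros cont_cut)
    show "\<bar>lam - (cut (y - H t))\<^sup>2\<bar> \<le> lam" for t y
      using cut_sq[of "y - H t"] by simp
    show "\<bar>lam - (cut (y - H t))\<^sup>2 - (lam - (cut (z - H t))\<^sup>2)\<bar> \<le> 2 * q * \<bar>y - z\<bar>" for t y z
    proof -
      define a b where "a = cut (y - H t)" and "b = cut (z - H t)"
      have "\<bar>lam - a\<^sup>2 - (lam - b\<^sup>2)\<bar> = \<bar>a + b\<bar> * \<bar>a - b\<bar>"
        by (simp add: power2_eq_square algebra_simps flip: abs_mult)
      also have "\<dots> \<le> (2 * q) * \<bar>y - z\<bar>"
        using cut[of "y - H t"] cut[of "z - H t"] cut_lip[of "y - H t" "z - H t"] q
        by (intro mult_mono) (auto simp: a_def b_def)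
      finally show ?thesis by (simp add: a_def b_def)
    qed
  qed (use q in auto)
  define x where "x t = w t - H t" for t
  define k where "k s = lam - (cut (x s))\<^sup>2" for s
  have cont_x: "continuous_on {0..} x"
    unfolding x_def by (intro continuous_intros w contH)
  have cont_k: "continuous_on {0..} k"
    unfolding k_def by (intro continuous_intros cont_cut cont_x)
  have int_k: "k integrable_on {s..t}" if "0 \<le> s" for s t
    by (rule integrable_continuous_interval, rule continuous_on_subset[OF cont_k]) (use that in auto)
  have int_h: "h integrable_on {s..t}" if "0 \<le> s" "s \<le> t" for s t
    by (rule integrable_subinterval_real[OF h(1)[of t]]) (use that in auto)
  have x_eq: "x t = \<mu> + integral {0..t} k - H t" if "t \<ge> 0" for t
    using w(2)[OF that] by (simp add: x_def k_def[abs_def])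
  have x_diff: "x t - x s = integral {s..t} k - integral {s..t} h" if "0 \<le> s" "s \<le> t" for s t
    using x_eq[of s] x_eq[of t] Henstock_Kurzweil_Integration.integral_combine[of 0 s t k]
      Henstock_Kurzweil_Integration.integral_combine[of 0 s t h] int_k[of 0 t] int_h[of 0 t] that
    by (simp add: H_def)
  have k_bounds: "0 \<le> k s" "k s \<le> lam" for s
    using cut_sq[of "x s"] by (auto simp: k_def)
  have k_int: "0 \<le> integral {s..t} k" "integral {s..t} k \<le> lam * (t - s)" if "0 \<le> s" "s \<le> t" for s t
    using integral_nonneg[OF int_k[of s t]] integral_le[OF int_k[of s t] integrable_const_ivl, of lam] k_bounds that
    by (auto simp: mult.commute)
  have h_int: "0 \<le> integral {s..t} h" "integral {s..t} h \<le> C * (t - s)" if "0 \<le> s" "s \<le> t" for s t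
    using integral_nonneg[OF int_h[of s t]] integral_le[OF int_h[of s t] integrable_const_ivl, of C] h that
    by (auto simp: mult.commute)
  have lower: "- q \<le> x t" if "t \<ge> 0" for t
    using x_eq[OF that] k_int(1)[of 0 t] H_le[OF that] that by (simp add: H_def q_def)
  have upper: "x t \<le> q" if t: "t \<ge> 0" for t
  proof (rule ccontr)
    assume xt: "\<not> x t \<le> q"
    obtain s where s: "s \<in> {0..t}" "x s \<le> q" "\<And>r. r \<in> {s<..t} \<Longrightarrow> x r > q"
      using last_time_le[of 0 t x q] continuous_on_subset[OF cont_x, of "{0..t}"] t \<mu> x_eq[of 0]
      by (auto simp: q_def H_def)
    have "integral {s..t} k = integral {s..t} (\<lambda>_. 0)"
    proof (rule integral_spike[OF negligible_sing[of s]])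
      fix r assume "r \<in> {s..t} - {s}"
      then have "cut (x r) = q" using s(3)[of r] q by (auto simp: cut_def)
      then show "0 = k r" using q by (simp add: k_def)
    qed
    then show False
      using x_diff[of s t] h_int(1)[of s t] s xt by auto
  qed
  \<comment> \<open>both integrands are bounded, so that \<open>x\<close> is even Lipschitz\<close>
  have "locally_abs_continuous_on {0..} x"
    unfolding locally_abs_continuous_on_def
  proof (intro allI impI)
    fix a b :: real assume ab: "a \<le> b" "{a..b} \<subseteq> {0..}"
    show "abs_continuous_on {a..b} x"
    proof (rule lipschitz_imp_abs_continuous_on)
      have C: "C \<ge> 0" using h(2,3)[of 0] by linarith
      then show "lam + C > 0" using lam by simp
      fix u v assume uv: "u \<in> {a..b}" "v \<in> {a..b}" "u \<le> v"
      then have "0 \<le> u" using ab by auto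
      then show "\<bar>x v - x u\<bar> \<le> (lam + C) * (v - u)"
        using x_diff[of u v] k_int[of u v] h_int[of u v] uv by (simp add: distrib_right abs_le_iff)
    qed
  qed
  moreover have "AE t in lebesgue. t \<in> {0..} \<longrightarrow>
      (x has_real_derivative lam - h t - (x t)\<^sup>2) (at t within {0..})"
  proof -
    have "\<exists>N. negligible N \<and> (\<forall>t\<in>{0<..<real n} - N. (H has_real_derivative h t) (at t))" for n
      unfolding H_def[abs_def] using indefinite_integral_has_derivative_ae[OF h(1)[of "real n"]]
      by (metis of_nat_0_le_iff)
    then obtain N where N: "\<And>n. negligible (N n)"
      "\<And>n t. t \<in> {0<..<real n} - N n \<Longrightarrow> (H has_real_derivative h t) (at t)"
      by metis
    have "negligible ((\<Union>n. N n) \<union> {0})"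
      using N(1) by (intro negligible_Un negligible_countable_Union) auto
    moreover have "(x has_real_derivative lam - h t - (x t)\<^sup>2) (at t within {0..})"
      if t: "t \<in> {0..}" "t \<notin> (\<Union>n. N n) \<union> {0}" for t
    proof -
      have t0: "t > 0" using t by auto
      obtain n :: nat where "t < real n" using reals_Archimedean2 by blast
      then have H': "(H has_real_derivative h t) (at t)" using N(2)[of t n] t t0 by auto
      have "((\<lambda>t. integral {0..t} k) has_real_derivative k t) (at t within {0..t + 1})"
        using t0 by (intro integral_has_real_derivative continuous_on_subset[OF cont_k]) auto
      then have k': "((\<lambda>t. integral {0..t} k) has_real_derivative k t) (at t)"
        using t0 by (simp add: at_within_Icc_at)
      have "((\<lambda>t. \<mu> + integral {0..t} k - H t) has_real_derivative k t - h t) (at t)"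
        by (auto intro!: derivative_eq_intros k' H')
      then have "(x has_real_derivative k t - h t) (at t)"
        by (rule has_field_derivative_transform_within_open[where S = "{0<..}"]) (use t0 x_eq in auto)
      moreover have "cut (x t) = x t"
        using lower[of t] upper[of t] t0 by (simp add: cut_def)
      ultimately show ?thesis
        by (simp add: k_def algebra_simps has_field_derivative_at_within)
    qed
    ultimately show ?thesis
      unfolding eventually_ae_filter_negligible by blast
  qed
  ultimately have "caratheodory_solution (\<lambda>t y. lam - h t - y\<^sup>2) \<mu> {0..} x"
    using x_eq[of 0] by (simp add: caratheodory_solution_def H_def)
  then show thesis
    using that lower by (simp add: q_def)
qed

text \<open>
  A solution that blows down has to cross the strip between \<open>\<mu>\<close> and \<open>- sqrt lam\<close>, of width
  \<open>sqrt lam + \<mu>\<close>. The drift \<open>lam - x\<^sup>2\<close> is nonnegative there, so the forcing alone pays for the descent.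
\<close>

lemma diverges_imp_forcing_mass:
  fixes \<alpha> :: "real \<Rightarrow> real"
  assumes lam: "lam > 0" and \<mu>: "\<mu> \<in> {- sqrt lam <..< sqrt lam}"
    and \<alpha>: "\<alpha> absolutely_integrable_on {0..}"
    and div: "diverges_to_minus_infinity (\<lambda>t y. lam - \<alpha> t - y\<^sup>2) \<mu>"
  shows "sqrt lam + \<mu> \<le> integral {0..} (\<lambda>t. max (\<alpha> t) 0)"
proof -
  define q where "q = sqrt lam"
  have q: "q > 0" "q\<^sup>2 = lam" using lam by (auto simp: q_def)
  obtain T x where T: "T > 0" and x: "caratheodory_solution (\<lambda>t y. lam - \<alpha> t - y\<^sup>2) \<mu> {0..<T} x"
    and lim: "filterlim x at_bot (at_left T)"
    using div unfolding diverges_to_minus_infinity_def by blast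
  have x0: "x 0 = \<mu>" and ac: "locally_abs_continuous_on {0..<T} x"
    and der: "AE t in lebesgue. t \<in> {0..<T} \<longrightarrow>
        (x has_real_derivative lam - \<alpha> t - (x t)\<^sup>2) (at t within {0..<T})"
    using x by (auto simp: caratheodory_solution_def)
  have "eventually (\<lambda>t. x t \<le> - q) (at_left T)"
    using lim by (simp add: filterlim_at_bot)
  moreover have "eventually (\<lambda>t. t \<in> {0<..<T}) (at_left T)"
    by (rule eventually_at_left_real[OF T])
  ultimately have "eventually (\<lambda>t. x t \<le> - q \<and> t \<in> {0<..<T}) (at_left T)"
    by eventually_elim simp
  then obtain b where b: "x b \<le> - q" "0 < b" "b < T"
    using eventually_happens'[OF trivial_limit_at_left_real] by auto
  have ac_sub: "abs_continuous_on {s..t} x" if "0 \<le> s" "s \<le> t" "t \<le> b" for s t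
  proof -
    have "{s..t} \<subseteq> {0..<T}" using that b by auto
    then show ?thesis using ac that unfolding locally_abs_continuous_on_def by blast
  qed
  have cont: "continuous_on {0..b} x"
    using b by (intro abs_continuous_on_imp_continuous_on ac_sub) auto
  \<comment> \<open>between \<open>s\<close> and \<open>t\<close> the solution descends from \<open>\<mu>\<close> to \<open>- q\<close> inside the strip where the drift is nonnegative\<close>
  obtain s where s: "s \<in> {0..b}" "x s \<ge> \<mu>" "\<And>r. r \<in> {s<..b} \<Longrightarrow> x r < \<mu>"
    using last_time_le[of 0 b "\<lambda>t. - x t" "- \<mu>"] continuous_on_minus[OF cont] b x0 by auto
  obtain t where t: "t \<in> {s..b}" "x t \<le> - q" "\<And>r. r \<in> {s..<t} \<Longrightarrow> x r > - q"
    using first_time_le[of s b x "- q"] continuous_on_subset[OF cont, of "{s..b}"] b s(1) by auto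
  from der obtain N where "negligible N" and sub: "{r. \<not> (r \<in> {0..<T} \<longrightarrow>
      (x has_real_derivative lam - \<alpha> r - (x r)\<^sup>2) (at r within {0..<T}))} \<subseteq> N"
    unfolding eventually_ae_filter_negligible by (elim exE conjE)
  have "((\<lambda>r. lam - \<alpha> r - (x r)\<^sup>2) has_integral x t - x s) {s..t}"
  proof (rule fundamental_theorem_abs_continuous[OF _ _ \<open>negligible N\<close>])
    fix r assume r: "r \<in> {s..t} - N"
    then have "r \<in> {0..<T}" using s t b by auto
    then have "(x has_real_derivative lam - \<alpha> r - (x r)\<^sup>2) (at r within {0..<T})"
      using sub r by auto
    then show "(x has_real_derivative lam - \<alpha> r - (x r)\<^sup>2) (at r within {s..t})"
      using s t b by (elim has_field_derivative_subset) auto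
  qed (use s t in \<open>auto intro: ac_sub\<close>)
  then have fund: "((\<lambda>r. lam - \<alpha> r - (x r)\<^sup>2) has_integral x t - x s) {s<..<t}"
    by (simp add: has_integral_Icc_iff_Ioo)
  have pos: "(\<lambda>r. max (\<alpha> r) 0) integrable_on {0..}"
    using absolutely_integrable_max_1[OF \<alpha>, of "\<lambda>_. 0"] by (simp add: set_lebesgue_integral_eq_integral(1))
  have pos_st: "(\<lambda>r. max (\<alpha> r) 0) integrable_on {s<..<t}"
    using integrable_on_subinterval[OF pos, of s t] s(1) by (auto simp: integrable_on_Icc_iff_Ioo)
  have "- integral {s<..<t} (\<lambda>r. max (\<alpha> r) 0) \<le> x t - x s"
  proof (rule has_integral_le[OF has_integral_neg[OF integrable_integral[OF pos_st]] fund])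
    fix r assume r: "r \<in> {s<..<t}"
    then have "\<bar>x r\<bar> \<le> q" using s(3)[of r] t(1) t(3)[of r] \<mu> by (auto simp: q_def)
    then have "(x r)\<^sup>2 \<le> lam" using q by (metis abs_le_square_iff abs_of_pos)
    then show "- max (\<alpha> r) 0 \<le> lam - \<alpha> r - (x r)\<^sup>2" by auto
  qed
  moreover have "integral {s<..<t} (\<lambda>r. max (\<alpha> r) 0) \<le> integral {0..} (\<lambda>r. max (\<alpha> r) 0)"
    using s(1) by (intro integral_subset_le pos pos_st) auto
  ultimately show ?thesis using s t by (simp add: q_def)
qed

section \<open>Rescaling on the half-line\<close>

lemma set_integrable_scale_halfline:
  fixes f :: "real \<Rightarrow> real"
  assumes "c > 0"
  shows "set_integrable lebesgue {0..} (\<lambda>s. f (s * c)) \<longleftrightarrow> set_integrable lebesgue {0..} f"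
  using lebesgue_integrable_real_affine_iff[of c "\<lambda>x. indicator {0..} x *\<^sub>R f x" 0] assms
  by (simp add: set_integrable_def indicator_def zero_le_mult_iff mult.commute)

lemma set_lebesgue_integral_scale_halfline:
  fixes f :: "real \<Rightarrow> real"
  assumes "c > 0"
  shows "(LINT s:{0..}|lebesgue. f (s * c)) = (LINT s:{0..}|lebesgue. f s) / c"
  using lebesgue_integral_real_affine[of c "\<lambda>x. indicator {0..} x *\<^sub>R f x" 0] assms
  by (simp add: set_lebesgue_integral_def indicator_def zero_le_mult_iff mult.commute)

lemma AE_lebesgue_scale:
  fixes c :: real
  assumes "c \<noteq> 0" "AE t in lebesgue. P t"
  shows "AE t in lebesgue. P (t * c)"
proof -
  obtain N where N: "negligible N" "{t. \<not> P t} \<subseteq> N"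
    using assms unfolding eventually_ae_filter_negligible by blast
  have "negligible ((\<lambda>t. t / c) ` N)"
    by (intro negligible_differentiable_image_negligible[OF order_refl N(1)])
      (use assms(1) in \<open>auto simp: differentiable_on_def intro!: derivative_intros\<close>)
  moreover have "{t. \<not> P (t * c)} \<subseteq> (\<lambda>t. t / c) ` N"
    using N(2) assms(1) by (auto intro!: image_eqI[of _ _ "_ * c"])
  ultimately show ?thesis
    unfolding eventually_ae_filter_negligible by blast
qed

text \<open>
  The substitution \<open>s = t * norm g / m\<close> gives the rescaled function the integral \<open>m\<close> for
  every nonzero \<open>g \<ge> 0\<close>; for \<open>g = 0\<close> the integral is 0, hence the inequality.
\<close>

lemma rescaled_integrable_bounded:
  assumes g: "g \<in> S_space {0..}" "AE t in lebesgue. t \<ge> 0 \<longrightarrow> g t \<ge> 0" and m: "m_const lam \<mu> > 0"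
  obtains D where "set_integrable lebesgue {0..} (rescaled lam \<mu> g)"
    "AE t in lebesgue. t \<ge> 0 \<longrightarrow> 0 \<le> rescaled lam \<mu> g t \<and> \<bar>rescaled lam \<mu> g t\<bar> \<le> D"
    "(LINT t:{0..}|lebesgue. rescaled lam \<mu> g t) \<le> m_const lam \<mu>"
proof (cases "L1_norm {0..} g = 0")
  case True
  show thesis
    by (rule that[of 0]) (use True m in \<open>auto simp: rescaled_def[abs_def]\<close>)
next
  case False
  obtain D where D: "AE t in lebesgue. t \<in> {0..} \<longrightarrow> \<bar>g t\<bar> \<le> D"
    using g(1) by (auto simp: S_space_def)
  have gi: "set_integrable lebesgue {0..} g" using g(1) by (simp add: S_space_def)
  have "L1_norm {0..} g \<ge> 0"
    unfolding L1_norm_def set_lebesgue_integral_def by (rule integral_nonneg_AE) auto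
  then have K: "K_tilde lam \<mu> g > 0" using False m by (simp add: K_tilde_def)
  have r: "rescaled lam \<mu> g = (\<lambda>t. g (t * K_tilde lam \<mu> g))"
    using False by (auto simp: rescaled_def)
  have L1: "L1_norm {0..} g = (LINT t:{0..}|lebesgue. g t)"
    unfolding L1_norm_def set_lebesgue_integral_def
  proof (rule integral_cong_AE)
    show "AE t in lebesgue. indicator {0..} t *\<^sub>R \<bar>g t\<bar> = indicator {0..} t *\<^sub>R g t"
      using g(2) by eventually_elim (auto simp: indicator_def)
    show "(\<lambda>t. indicator {0..} t *\<^sub>R g t) \<in> borel_measurable lebesgue"
      using gi unfolding set_integrable_def by (rule borel_measurable_integrable)
    show "(\<lambda>t. indicator {0..} t *\<^sub>R \<bar>g t\<bar>) \<in> borel_measurable lebesgue"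
      using set_integrable_abs[OF gi] unfolding set_integrable_def by (rule borel_measurable_integrable)
  qed
  show thesis
  proof (rule that)
    show "set_integrable lebesgue {0..} (rescaled lam \<mu> g)"
      unfolding r using gi by (simp add: set_integrable_scale_halfline[OF K])
    have "AE t in lebesgue. t * K_tilde lam \<mu> g \<ge> 0 \<longrightarrow>
        0 \<le> g (t * K_tilde lam \<mu> g) \<and> \<bar>g (t * K_tilde lam \<mu> g)\<bar> \<le> D"
      by (rule AE_lebesgue_scale) (use K g(2) D in \<open>auto elim: eventually_elim2\<close>)
    then show "AE t in lebesgue. t \<ge> 0 \<longrightarrow> 0 \<le> rescaled lam \<mu> g t \<and> \<bar>rescaled lam \<mu> g t\<bar> \<le> D"
      unfolding r by eventually_elim (use K in \<open>auto simp: zero_le_mult_iff\<close>)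
    show "(LINT t:{0..}|lebesgue. rescaled lam \<mu> g t) \<le> m_const lam \<mu>"
      unfolding r set_lebesgue_integral_scale_halfline[OF K] L1[symmetric]
      using False m by (simp add: K_tilde_def)
  qed
qed

section \<open>Mean-square approximation by positive parts\<close>

lemma integrable_power2_bounded:
  fixes f :: "'a \<Rightarrow> real"
  assumes f: "integrable M f" and "AE x in M. \<bar>f x\<bar> \<le> C"
  shows "integrable M (\<lambda>x. (f x)\<^sup>2)"
proof (rule Bochner_Integration.integrable_bound[OF integrable_mult_right[OF f, of C]])
  show "(\<lambda>x. (f x)\<^sup>2) \<in> borel_measurable M"
    using borel_measurable_integrable[OF f] by measurable
  show "AE x in M. norm ((f x)\<^sup>2) \<le> norm (C * f x)"
    using assms(2)
  proof eventually_elim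
    case (elim x)
    then have "\<bar>f x\<bar> * \<bar>f x\<bar> \<le> \<bar>C\<bar> * \<bar>f x\<bar>" by (intro mult_right_mono) auto
    then show ?case by (simp add: power2_eq_square abs_mult)
  qed
qed

text \<open>
  Among the nonnegative functions of no larger integral, \<open>p = (a - c)\<^sup>+\<close> is the best approximation of
  \<open>a\<close> in mean square. Convexity of the square and \<open>(a - p) * (p - h) \<ge> c * (p - h)\<close> give
  \<open>(a - h)\<^sup>2 \<ge> (a - p)\<^sup>2 + 2 * c * (p - h)\<close> pointwise: \<open>a - p\<close> equals \<open>c\<close> where \<open>p > 0\<close>, and where
  \<open>p = 0\<close> it is at most \<open>c\<close> while \<open>p - h \<le> 0\<close>.
\<close>

lemma positive_part_best_approximation:
  fixes a h :: "'a \<Rightarrow> real"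
  assumes a: "integrable M a" "AE x in M. \<bar>a x\<bar> \<le> C"
    and h: "integrable M h" "AE x in M. \<bar>h x\<bar> \<le> D" "AE x in M. 0 \<le> h x"
    and c: "c \<ge> 0" and le: "integral\<^sup>L M h \<le> integral\<^sup>L M (\<lambda>x. max (a x - c) 0)"
  shows "(LINT x|M. (a x - max (a x - c) 0)\<^sup>2) \<le> (LINT x|M. (a x - h x)\<^sup>2)"
proof -
  have p: "integrable M (\<lambda>x. max (a x - c) 0)"
    using borel_measurable_integrable[OF a(1)] c
    by (intro Bochner_Integration.integrable_bound[OF a(1)]) auto
  have "integrable M (\<lambda>x. (a x - max (a x - c) 0)\<^sup>2)"
  proof (rule integrable_power2_bounded)
    show "integrable M (\<lambda>x. a x - max (a x - c) 0)" using a p by simp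
    show "AE x in M. \<bar>a x - max (a x - c) 0\<bar> \<le> C"
      using a(2) by eventually_elim (use c in auto)
  qed
  then have int: "integrable M (\<lambda>x. (a x - max (a x - c) 0)\<^sup>2 + 2 * c * (max (a x - c) 0 - h x))"
    using p h by simp
  have int2: "integrable M (\<lambda>x. (a x - h x)\<^sup>2)"
  proof (rule integrable_power2_bounded)
    show "integrable M (\<lambda>x. a x - h x)" using a h by simp
    show "AE x in M. \<bar>a x - h x\<bar> \<le> C + D"
      using a(2) h(2) by eventually_elim auto
  qed
  have "0 \<le> 2 * c * (integral\<^sup>L M (\<lambda>x. max (a x - c) 0) - integral\<^sup>L M h)"
    using c le by simp
  then have "(LINT x|M. (a x - max (a x - c) 0)\<^sup>2) \<le>
      (LINT x|M. (a x - max (a x - c) 0)\<^sup>2 + 2 * c * (max (a x - c) 0 - h x))"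
    using p h \<open>integrable M (\<lambda>x. (a x - max (a x - c) 0)\<^sup>2)\<close> by simp
  also have "\<dots> \<le> (LINT x|M. (a x - h x)\<^sup>2)"
  proof (rule integral_mono_AE[OF int int2])
    have "(y - max (y - c) 0)\<^sup>2 + 2 * c * (max (y - c) 0 - z) \<le> (y - z)\<^sup>2" if "0 \<le> z" for y z
    proof (cases "y \<ge> c")
      case True
      have "0 \<le> (y - c - z)\<^sup>2" by simp
      with True show ?thesis by (simp add: max_def power2_eq_square algebra_simps)
    next
      case False
      have "(y - z)\<^sup>2 = y\<^sup>2 + 2 * c * (- z) + (2 * z * (c - y) + z\<^sup>2)"
        by (simp add: power2_eq_square algebra_simps)
      moreover have "0 \<le> 2 * z * (c - y)" using False that by auto
      ultimately show ?thesis using False by simp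
    qed
    then show "AE x in M. (a x - max (a x - c) 0)\<^sup>2 + 2 * c * (max (a x - c) 0 - h x) \<le> (a x - h x)\<^sup>2"
      using h(3) by auto
  qed
  finally show ?thesis .
qed

text \<open>
  The integral of \<open>(a - c)\<^sup>+\<close> depends continuously on \<open>c\<close> and vanishes at an essential bound of \<open>a\<close>.
\<close>

lemma positive_part_level_exists:
  fixes a :: "'a \<Rightarrow> real"
  assumes a: "integrable M a" "AE x in M. \<bar>a x\<bar> \<le> C"
    and m: "0 \<le> m" "m \<le> (LINT x|M. max (a x) 0)"
  obtains c where "c \<ge> 0" "(LINT x|M. max (a x - c) 0) = m"
proof -
  define B where "B = max C 0"
  define \<psi> where "\<psi> c = (LINT x|M. max (a x - c) 0)" for c
  have [measurable]: "a \<in> borel_measurable M" using a by simp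
  have "continuous_on {0..B} \<psi>"
    unfolding continuous_on_sequentially
  proof (intro allI ballI impI)
    fix u c assume u: "c \<in> {0..B}" "(\<forall>n. u n \<in> {0..B}) \<and> u \<longlonglongrightarrow> c"
    show "(\<psi> \<circ> u) \<longlonglongrightarrow> \<psi> c"
      unfolding \<psi>_def o_def
    proof (rule integral_dominated_convergence)
      show "integrable M (\<lambda>x. \<bar>a x\<bar>)" using a by simp
      show "AE x in M. (\<lambda>n. max (a x - u n) 0) \<longlonglongrightarrow> max (a x - c) 0"
        using u by (intro AE_I2 tendsto_intros) auto
      fix n
      have "0 \<le> u n" using u by auto
      then show "AE x in M. norm (max (a x - u n) 0) \<le> \<bar>a x\<bar>"
        by auto
    qed auto
  qed
  moreover have "\<psi> B = 0"
  proof -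
    have "\<psi> B = (LINT x|M. 0)"
      unfolding \<psi>_def
    proof (rule integral_cong_AE)
      show "AE x in M. max (a x - B) 0 = 0"
        using a(2) by eventually_elim (auto simp: B_def)
    qed auto
    then show ?thesis by simp
  qed
  moreover have "m \<le> \<psi> 0" using m by (simp add: \<psi>_def)
  ultimately obtain c where "0 \<le> c" "c \<le> B" "\<psi> c = m"
    using IVT2'[of \<psi> B m 0] m(1) by (auto simp: B_def)
  then show thesis using that by (simp add: \<psi>_def)
qed

section \<open>The optimal control\<close>

theorem theorem5p1:
  fixes lam \<mu> :: real and \<alpha> :: "real \<Rightarrow> real"
  assumes "lam > 0"
    and "\<mu> \<in> {- sqrt lam <..< sqrt lam}"
    and "\<alpha> \<in> S_space UNIV"
    and "AE t in lebesgue. \<alpha> t \<ge> 0"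
    and "diverges_to_minus_infinity (\<lambda>t y. lam - \<alpha> t - y\<^sup>2) \<mu>"
  shows "(\<exists>\<nu>\<ge>0. (LINT s:{0..}|lebesgue. max (\<alpha> (s * m_const lam \<mu>) - \<nu> / 2) 0) = 1) \<and>
    (\<forall>\<nu>\<ge>0. (LINT s:{0..}|lebesgue. max (\<alpha> (s * m_const lam \<mu>) - \<nu> / 2) 0) = 1 \<longrightarrow>
       is_arg_min (g_cost lam \<alpha> \<mu>) g_feasible (g_opt lam \<alpha> \<mu> \<nu>) \<and>
       OCP_admissible lam \<alpha> \<mu> (u_opt \<alpha> \<nu>) \<and>
       (\<forall>s\<ge>0. u_opt \<alpha> \<nu> s =
          \<alpha> s - g_opt lam \<alpha> \<mu> \<nu> (s * K_tilde lam \<mu> (g_opt lam \<alpha> \<mu> \<nu>))))"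
proof -
  define m where "m = m_const lam \<mu>"
  have m: "m > 0" "m = sqrt lam + \<mu>" using assms(2) by (auto simp: m_def m_const_def)
  define a where "a t = indicator {0..} t * \<alpha> t" for t :: real
  have \<alpha>_int: "set_integrable lebesgue {0..} \<alpha>"
    using assms(3) by (auto simp: S_space_def intro: set_integrable_subset)
  then have a: "integrable lebesgue a"
    by (simp add: set_integrable_def a_def[abs_def])
  obtain C0 where "AE t in lebesgue. \<bar>\<alpha> t\<bar> \<le> C0"
    using assms(3) by (auto simp: S_space_def)
  moreover define C where "C = max C0 0"
  ultimately have C: "C \<ge> 0" "AE t in lebesgue. \<bar>\<alpha> t\<bar> \<le> C"
    by (auto elim: eventually_mono)
  have a_le: "AE t in lebesgue. \<bar>a t\<bar> \<le> C"
    using C(2) by eventually_elim (use C(1) in \<open>auto simp: a_def indicator_def\<close>)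
  \<comment> \<open>for \<open>c \<ge> 0\<close> extending by zero commutes with taking \<open>(\<alpha> - c)\<^sup>+\<close>, as \<open>(0 - c)\<^sup>+ = 0\<close>\<close>
  have pos_ind: "indicator {0..} t * max (\<alpha> t - c) 0 = max (a t - c) 0" if "c \<ge> 0" for c t :: real
    using that by (auto simp: a_def indicator_def)
  have level: "(LINT s:{0..}|lebesgue. max (\<alpha> (s * m) - c) 0) = (LINT t|lebesgue. max (a t - c) 0) / m"
    if "c \<ge> 0" for c
    using set_lebesgue_integral_scale_halfline[OF m(1), of "\<lambda>t. max (\<alpha> t - c) 0"]
    by (simp add: set_lebesgue_integral_def pos_ind[OF that])
  have pos_int: "set_integrable lebesgue {0..} (\<lambda>t. max (\<alpha> t - c) 0)" if "c \<ge> 0" for c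
    unfolding set_integrable_def real_scaleR_def pos_ind[OF that]
    using borel_measurable_integrable[OF a] that
    by (intro Bochner_Integration.integrable_bound[OF a]) auto
  have "m \<le> integral {0..} (\<lambda>t. max (\<alpha> t) 0)"
    unfolding m by (rule diverges_imp_forcing_mass[OF assms(1,2) \<alpha>_int assms(5)])
  also have "\<dots> = (LINT t|lebesgue. max (a t) 0)"
    using set_lebesgue_integral_eq_integral(2)[OF pos_int[of 0]] pos_ind[of 0]
    by (simp add: set_lebesgue_integral_def)
  finally have mass: "m \<le> (LINT t|lebesgue. max (a t) 0)" .
  obtain c where c: "c \<ge> 0" "(LINT t|lebesgue. max (a t - c) 0) = m"
    using positive_part_level_exists[OF a a_le _ mass] m(1) by auto
  have "\<exists>\<nu>\<ge>0. (LINT s:{0..}|lebesgue. max (\<alpha> (s * m) - \<nu> / 2) 0) = 1"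
    using level[OF c(1)] c m(1) by (intro exI[of _ "2 * c"]) simp
  moreover have "is_arg_min (g_cost lam \<alpha> \<mu>) g_feasible (g_opt lam \<alpha> \<mu> \<nu>) \<and>
       OCP_admissible lam \<alpha> \<mu> (u_opt \<alpha> \<nu>) \<and>
       (\<forall>s\<ge>0. u_opt \<alpha> \<nu> s =
          \<alpha> s - g_opt lam \<alpha> \<mu> \<nu> (s * K_tilde lam \<mu> (g_opt lam \<alpha> \<mu> \<nu>)))"
    if \<nu>: "\<nu> \<ge> 0" "(LINT s:{0..}|lebesgue. max (\<alpha> (s * m) - \<nu> / 2) 0) = 1" for \<nu>
  proof (intro conjI)
    define p where "p t = max (\<alpha> t - \<nu> / 2) 0" for t
    have p_mass: "(LINT t|lebesgue. max (a t - \<nu> / 2) 0) = m"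
      using \<nu> level[of "\<nu> / 2"] m(1) by simp
    have p_int: "set_integrable lebesgue {0..} p"
      unfolding p_def[abs_def] using \<nu> by (intro pos_int) simp
    have p_integral: "integral {0..} p = m"
      using set_lebesgue_integral_eq_integral(2)[OF p_int] p_mass pos_ind[of "\<nu> / 2"] \<nu>
      by (simp add: set_lebesgue_integral_def p_def)
    have p_bounds: "AE t in lebesgue. 0 \<le> p t \<and> p t \<le> C"
      using C(2) by eventually_elim (use C(1) \<nu> in \<open>auto simp: p_def\<close>)
    have g_opt: "g_opt lam \<alpha> \<mu> \<nu> = (\<lambda>s. p (s * m))"
      by (simp add: g_opt_def[abs_def] p_def m_def)
    have L1: "L1_norm {0..} (g_opt lam \<alpha> \<mu> \<nu>) = 1"
      using \<nu>(2) by (simp add: L1_norm_def g_opt p_def)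
    then have K: "K_tilde lam \<mu> (g_opt lam \<alpha> \<mu> \<nu>) = 1 / m"
      by (simp add: K_tilde_def m_def)
    have resc: "rescaled lam \<mu> (g_opt lam \<alpha> \<mu> \<nu>) t = p t" for t
      using L1 K m(1) by (simp add: rescaled_def g_opt)
    show "\<forall>s\<ge>0. u_opt \<alpha> \<nu> s =
          \<alpha> s - g_opt lam \<alpha> \<mu> \<nu> (s * K_tilde lam \<mu> (g_opt lam \<alpha> \<mu> \<nu>))"
      unfolding K using m(1) by (simp add: u_opt_def g_opt p_def)
    show "is_arg_min (g_cost lam \<alpha> \<mu>) g_feasible (g_opt lam \<alpha> \<mu> \<nu>)"
      unfolding is_arg_min_linorder
    proof (intro conjI allI impI)
      have "AE s in lebesgue. 0 \<le> p (s * m) \<and> p (s * m) \<le> C"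
        by (rule AE_lebesgue_scale[OF _ p_bounds]) (use m in auto)
      then have "AE s in lebesgue. s \<in> {0..} \<longrightarrow> \<bar>p (s * m)\<bar> \<le> C"
        by eventually_elim auto
      then show "g_feasible (g_opt lam \<alpha> \<mu> \<nu>)"
        using p_int set_integrable_scale_halfline[OF m(1), of p]
        by (auto simp: g_feasible_def S_space_def g_opt) (simp add: p_def)
      fix g assume "g_feasible g"
      then have g: "g \<in> S_space {0..}" "AE t in lebesgue. t \<ge> 0 \<longrightarrow> g t \<ge> 0"
        by (auto simp: g_feasible_def)
      obtain D where D: "set_integrable lebesgue {0..} (rescaled lam \<mu> g)"
        "AE t in lebesgue. t \<ge> 0 \<longrightarrow> 0 \<le> rescaled lam \<mu> g t \<and> \<bar>rescaled lam \<mu> g t\<bar> \<le> D"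
        "(LINT t:{0..}|lebesgue. rescaled lam \<mu> g t) \<le> m"
        unfolding m_def by (rule rescaled_integrable_bounded[OF g m(1)[unfolded m_def]])
      define h where "h t = indicator {0..} t *\<^sub>R rescaled lam \<mu> g t" for t :: real
      have "(LINT t|lebesgue. (a t - max (a t - \<nu> / 2) 0)\<^sup>2) \<le> (LINT t|lebesgue. (a t - h t)\<^sup>2)"
      proof (rule positive_part_best_approximation[OF a a_le])
        show "integrable lebesgue h"
          using D(1) by (simp add: set_integrable_def h_def[abs_def])
        show "AE t in lebesgue. \<bar>h t\<bar> \<le> \<bar>D\<bar>" "AE t in lebesgue. 0 \<le> h t"
          using D(2) by (eventually_elim, auto simp: h_def indicator_def)+
        show "integral\<^sup>L lebesgue h \<le> (LINT t|lebesgue. max (a t - \<nu> / 2) 0)"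
          using D(3) p_mass by (simp add: set_lebesgue_integral_def h_def[abs_def])
      qed (use \<nu> in simp)
      also have "(LINT t|lebesgue. (a t - max (a t - \<nu> / 2) 0)\<^sup>2) = g_cost lam \<alpha> \<mu> (g_opt lam \<alpha> \<mu> \<nu>)"
        unfolding g_cost_def set_lebesgue_integral_def resc using \<nu>
        by (intro Bochner_Integration.integral_cong) (auto simp: a_def p_def indicator_def)
      also have "(LINT t|lebesgue. (a t - h t)\<^sup>2) = g_cost lam \<alpha> \<mu> g"
        unfolding g_cost_def set_lebesgue_integral_def
        by (intro Bochner_Integration.integral_cong) (auto simp: a_def h_def indicator_def)
      finally show "g_cost lam \<alpha> \<mu> (g_opt lam \<alpha> \<mu> \<nu>) \<le> g_cost lam \<alpha> \<mu> g" .
    qed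
    have u: "u_opt \<alpha> \<nu> t = \<alpha> t - p t" for t by (simp add: u_opt_def p_def)
    have u_S: "u_opt \<alpha> \<nu> \<in> S_space {0..}"
    proof -
      have "AE t in lebesgue. t \<in> {0..} \<longrightarrow> \<bar>u_opt \<alpha> \<nu> t\<bar> \<le> C + C"
        using C(2) p_bounds by eventually_elim (auto simp: u)
      then show ?thesis
        using set_integral_diff(1)[OF \<alpha>_int p_int] by (auto simp: S_space_def u[abs_def])
    qed
    \<comment> \<open>truncating \<open>p\<close> at its essential bound changes it on a null set only\<close>
    define h where "h t = min (p t) C" for t
    have h_eq: "AE t in lebesgue. h t = p t"
      using p_bounds by eventually_elim (auto simp: h_def)
    then obtain N where N: "negligible N" "\<And>t. t \<notin> N \<Longrightarrow> h t = p t"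
      unfolding eventually_ae_filter_negligible by blast
    have p_on: "p integrable_on {0..}" by (rule set_lebesgue_integral_eq_integral(1)[OF p_int])
    have p_on': "p integrable_on {0..t}" for t
      by (rule integrable_on_subinterval[OF p_on]) auto
    obtain x where x: "caratheodory_solution (\<lambda>t y. lam - h t - y\<^sup>2) \<mu> {0..} x"
      "\<And>t. t \<ge> 0 \<Longrightarrow> x t \<ge> - sqrt lam"
    proof (rule riccati_global_solution[OF assms(1)])
      show "\<mu> \<in> {- sqrt lam..sqrt lam}" using assms(2) by auto
      show "h integrable_on {0..t}" for t
        by (rule integrable_spike[OF p_on' N(1)]) (use N(2) in auto)
      show "0 \<le> h t" "h t \<le> C" for t using C(1) by (auto simp: h_def p_def)
      have "integral {0..t} h = integral {0..t} p" for t
        by (rule integral_spike[OF N(1)]) (use N(2) in auto)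
      moreover have "integral {0..t} p \<le> integral {0..} p" for t
        by (rule integral_subset_le[OF _ p_on' p_on]) (auto simp: p_def)
      ultimately show "integral {0..t} h \<le> sqrt lam + \<mu>" for t
        using p_integral m(2) by simp
    qed blast
    have "caratheodory_solution (\<lambda>t y. lam - \<alpha> t + u_opt \<alpha> \<nu> t - y\<^sup>2) \<mu> {0..} x"
      unfolding caratheodory_solution_def
    proof (intro conjI)
      have "AE t in lebesgue. t \<in> {0..} \<longrightarrow> (x has_real_derivative lam - h t - (x t)\<^sup>2) (at t within {0..})"
        using x(1) by (simp add: caratheodory_solution_def)
      then show "AE t in lebesgue. t \<in> {0..} \<longrightarrow>
          (x has_real_derivative lam - \<alpha> t + u_opt \<alpha> \<nu> t - (x t)\<^sup>2) (at t within {0..})"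
        using h_eq by eventually_elim (simp add: u)
    qed (use x(1) in \<open>auto simp: caratheodory_solution_def\<close>)
    moreover have "\<forall>t\<ge>0. x t \<ge> - real (nat \<lceil>sqrt lam\<rceil>)"
    proof (intro allI impI)
      fix t :: real assume "t \<ge> 0"
      from x(2)[OF this] show "x t \<ge> - real (nat \<lceil>sqrt lam\<rceil>)" using real_nat_ceiling_ge[of "sqrt lam"] by linarith
    qed
    ultimately show "OCP_admissible lam \<alpha> \<mu> (u_opt \<alpha> \<nu>)"
      using u_S unfolding OCP_admissible_def by blast
  qed
  ultimately show ?thesis unfolding m_def by blast
qed

end
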